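(* Let $K\subset \mathbb{R}^n$ be a closed convex set containing the origin in its interior. If $\sigma:\mathbb{R}^n\rightarrow \mathbb{R}$ is a sublinear function such that $K=\{x \in \mathbb{R}^n \mid \sigma(x)\leq 1\}$, then $\sigma_{\hat K}(x)\leq \sigma(x)$ for all $x\in\mathbb{R}^n$.
   Context: $\langle\cdot,\cdot\rangle$ is the standard inner product on $\mathbb{R}^n$. For $K\subseteq\mathbb{R}^n$, the polar of $K$ is $K^* = \{y\in\mathbb{R}^n\mid \langle x,y \rangle \leq 1 \text{ for all } x\in K\}$, and $\hat K = \{y\in K^* \mid \langle x,y \rangle = 1 \text{ for some } x\in K\}$. The support function of a nonempty set $T\subset \mathbb{R}^n$ is defined by $\sigma_T(x)=\sup_{y\in T}\langle x,y \rangle$ for all $x\in\mathbb{R}^n$; $\sigma_{\hat K}$ denotes the support function of $\hat K$. A function $f:\mathbb{R}^n\to\mathbb{R}$ is positively homogeneous if $f(tx)=tf(x)$ for every $x\in\mathbb{R}^n$ and $t>0$, and sublinear if it is convex and positively homogeneous. *)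

theory Defs
  imports "HOL-Analysis.Analysis"
begin

definition polar :: "(real ^ 'n) set \<Rightarrow> (real ^ 'n) set"
  where "polar K = {y. \<forall>x\<in>K. x \<bullet> y \<le> 1}"

definition polar_hat :: "(real ^ 'n) set \<Rightarrow> (real ^ 'n) set"
  where "polar_hat K = {y \<in> polar K. \<exists>x\<in>K. x \<bullet> y = 1}"

(* Extended-real valued, so that the supremum over the empty set is -\<infinity>; this matters
   because polar_hat UNIV = {}. *)
definition support_fun :: "(real ^ 'n) set \<Rightarrow> real ^ 'n \<Rightarrow> ereal"
  where "support_fun T x = (SUP y\<in>T. ereal (x \<bullet> y))"

definition positively_homogeneous :: "(real ^ 'n \<Rightarrow> real) \<Rightarrow> bool"
  where "positively_homogeneous f \<longleftrightarrow> (\<forall>x t. 0 < t \<longrightarrow> f (t *\<^sub>R x) = t * f x)"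

definition sublinear :: "(real ^ 'n \<Rightarrow> real) \<Rightarrow> bool"
  where "sublinear f \<longleftrightarrow> convex_on UNIV f \<and> positively_homogeneous f"

end

(* If y is in the polar of K and <x0, y> = 1 with x0 in K, then for small t > 0 the number
   c = 1 + t * sigma x is positive and sigma (x0 + t x) <= c by subadditivity, so (x0 + t x) / c
   lies in K. Pairing with y gives 1 + t <x, y> <= 1 + t * sigma x, that is <x, y> <= sigma x. *)
theory Submission
  imports Defs
begin

lemma sublinear_scaleR:
  assumes "sublinear f" "0 < t"
  shows "f (t *\<^sub>R x) = t * f x"
  using assms by (simp add: sublinear_def positively_homogeneous_def)

text \<open>Midpoint convexity applied to the doubled points; homogeneity then absorbs the factors 2
  and 1/2.\<close>

lemma sublinear_add_le:
  assumes "sublinear f"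
  shows "f (x + y) \<le> f x + f y"
proof -
  have "f ((1/2) *\<^sub>R (2 *\<^sub>R x) + (1/2) *\<^sub>R (2 *\<^sub>R y)) \<le> (1/2) * f (2 *\<^sub>R x) + (1/2) * f (2 *\<^sub>R y)"
    using convex_onD[of UNIV f "1/2" "2 *\<^sub>R x" "2 *\<^sub>R y"] assms by (simp add: sublinear_def)
  then show ?thesis
    by (simp add: sublinear_scaleR[OF assms])
qed

lemma inner_polar_hat_le:
  assumes f: "sublinear f" and y: "y \<in> polar_hat {x. f x \<le> 1}"
  shows "x \<bullet> y \<le> f x"
proof -
  obtain x0 where x0: "f x0 \<le> 1" "x0 \<bullet> y = 1"
    using y by (auto simp: polar_hat_def)
  \<comment> \<open>This choice gives \<open>\<bar>t * f x\<bar> < 1\<close>, so \<open>c\<close>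
    below stays positive even if \<open>f x\<close> is negative.\<close>
  define t where "t = 1 / (1 + \<bar>f x\<bar>)"
  define c where "c = 1 + t * f x"
  have t: "0 < t"
    by (simp add: t_def add_pos_nonneg)
  have c: "0 < c"
    by (simp add: c_def t_def field_simps add_pos_nonneg)
  have "f (x0 + t *\<^sub>R x) \<le> c"
    using sublinear_add_le[OF f, of x0 "t *\<^sub>R x"] x0(1)
    by (simp add: sublinear_scaleR[OF f t] c_def)
  then have "f ((1/c) *\<^sub>R (x0 + t *\<^sub>R x)) \<le> 1"
    using c by (simp add: sublinear_scaleR[OF f] del: scaleR_add_right)
  then have "((1/c) *\<^sub>R (x0 + t *\<^sub>R x)) \<bullet> y \<le> 1"
    using y unfolding polar_hat_def polar_def by blast
  then have "(x0 + t *\<^sub>R x) \<bullet> y \<le> c"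
    using c by (simp add: divide_le_eq del: scaleR_add_right)
  then show ?thesis
    using x0(2) t by (simp add: inner_add_left c_def)
qed

theorem theorem1:
  fixes K :: "(real ^ 'n) set" and \<sigma> :: "real ^ 'n \<Rightarrow> real"
  assumes "closed K" and "convex K" and "0 \<in> interior K"
    and "sublinear \<sigma>" and "K = {x. \<sigma> x \<le> 1}"
  shows "\<forall>x. support_fun (polar_hat K) x \<le> ereal (\<sigma> x)"
  \<comment> \<open>The pointwise bound passes to the supremum; if \<open>polar_hat K\<close> is
    empty, the supremum is -\<infinity> and the bound is trivial.\<close>
  using inner_polar_hat_le[OF assms(4)] assms(5)
  by (auto simp: support_fun_def intro!: SUP_least)

end
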